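(* Let $(E,T,S,e)$ be a conditionally ergodic conditional expectation preserving system with $T$ strictly positive, $E$ $T$-universally complete and $S$ surjective. Let $n\in\mathbb{N}$ and let $p$ be a component of $e$. Then there exists a component $q$ of $P_{Tp}e$ such that $q,Sq,\dots,S^{n-1}q$ are pairwise disjoint and $$T\left(\bigvee_{j=0}^{n-1}S^jq\right)\ge \left(P_{Tp}e-(n-1)Tp\right)^+.$$
   Context: $\mathbb{N}=\{1,2,\dots\}$. For an Archimedean Riesz space $E$ with weak order unit, a conditional expectation on $E$ is a positive order continuous linear projection $T:E\to E$ which maps weak order units to weak order units and whose range $R(T)$ is a Dedekind complete Riesz subspace of $E$. $T$ is strictly positive if $f\in E_+$ and $Tf=0$ imply $f=0$. A conditional expectation preserving system (CEPS) is a 4-tuple $(E,T,S,e)$ where $E$ is a Dedekind complete Riesz space, $e$ is a weak order unit of $E$, $T$ is a conditional expectation on $E$ with $Te=e$, and $S$ is an order continuous Riesz homomorphism on $E$ with $Se=e$ and $TSf=Tf$ for all $f\in E$. $E^u$ denotes the universal completion of $E$. $E$ is $T$-universally complete if for each upwards directed net $(f_\alpha)$ in $E_+$ such that $(Tf_\alpha)$ is order bounded in $E^u$, the net $(f_\alpha)$ is order convergent in $E$. If $E$ is $T$-universally complete, then for each $f\in E$ the order limit $L_Sf:=\lim_{n\to\infty}\frac1n\sum_{k=0}^{n-1}S^kf$ exists in $E$. The system is conditionally ergodic if $L_S=T$ (equivalently $\{f\in E: Sf=f\}=R(T)$). $p\in E_+$ is a component of $q\in E_+$ if $p\le q$ and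 $(q-p)\wedge p=0$. Elements $f,g\in E_+$ are disjoint if $f\wedge g=0$. For $f\in E_+$, $P_f$ denotes the band projection of $E$ onto the band generated by $f$. *)

theory Defs
  imports Complex_Main "HOL-Library.Lattice_Algebras"
begin

class riesz_space = ordered_real_vector + lattice_ab_group_add_abs

class dedekind_complete_riesz_space = riesz_space + conditionally_complete_lattice

definition disjoint_elems :: "'a::riesz_space \<Rightarrow> 'a \<Rightarrow> bool" where
  "disjoint_elems f g \<longleftrightarrow> inf \<bar>f\<bar> \<bar>g\<bar> = 0"

definition disjoint_complement :: "'a::riesz_space set \<Rightarrow> 'a set" where
  "disjoint_complement A = {x. \<forall>a\<in>A. disjoint_elems x a}"

definition component_of :: "'a::riesz_space \<Rightarrow> 'a \<Rightarrow> bool" where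
  "component_of p q \<longleftrightarrow> 0 \<le> p \<and> 0 \<le> q \<and> p \<le> q \<and> inf (q - p) p = 0"

definition is_lub_in :: "'a::order set \<Rightarrow> 'a set \<Rightarrow> 'a \<Rightarrow> bool" where
  "is_lub_in R A s \<longleftrightarrow> s \<in> R \<and> (\<forall>a\<in>A. a \<le> s) \<and> (\<forall>u\<in>R. (\<forall>a\<in>A. a \<le> u) \<longrightarrow> s \<le> u)"

subsection \<open>Bands, weak order units, band projections\<close>

definition order_ideal :: "'a::riesz_space set \<Rightarrow> bool" where
  "order_ideal B \<longleftrightarrow> subspace B \<and> (\<forall>x y. y \<in> B \<longrightarrow> \<bar>x\<bar> \<le> \<bar>y\<bar> \<longrightarrow> x \<in> B)"

definition band :: "'a::riesz_space set \<Rightarrow> bool" where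
  "band B \<longleftrightarrow> order_ideal B \<and> (\<forall>A s. A \<subseteq> B \<longrightarrow> is_lub_in UNIV A s \<longrightarrow> s \<in> B)"

definition band_generated :: "'a::riesz_space \<Rightarrow> 'a set" where
  "band_generated f = \<Inter>{B. band B \<and> f \<in> B}"

definition weak_order_unit :: "'a::riesz_space \<Rightarrow> bool" where
  "weak_order_unit e \<longleftrightarrow> 0 \<le> e \<and> band_generated e = UNIV"

text \<open>The projection along the decomposition of the space as the direct sum of the band
  \<open>B\<close> generated by \<open>f\<close> and its disjoint complement; in a Dedekind complete
  space this decomposition exists for every \<open>f\<close>.\<close>

definition band_proj :: "'a::dedekind_complete_riesz_space \<Rightarrow> 'a \<Rightarrow> 'a" where
  "band_proj f x =
     (THE b. b \<in> band_generated f \<and> x - b \<in> disjoint_complement (band_generated f))"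

subsection \<open>Order convergence\<close>

definition decreases_to_zero :: "'a::riesz_space set \<Rightarrow> bool" where
  "decreases_to_zero G \<longleftrightarrow> G \<noteq> {} \<and> (\<forall>g\<in>G. \<forall>h\<in>G. \<exists>k\<in>G. k \<le> g \<and> k \<le> h) \<and>
     (\<forall>g\<in>G. 0 \<le> g) \<and> (\<forall>z. (\<forall>g\<in>G. z \<le> g) \<longrightarrow> z \<le> 0)"

text \<open>Nets are rendered by filters: \<open>f\<close> converges in order to \<open>l\<close> if there is a
  downwards directed family with infimum 0, each member of which eventually dominates
  the distance of \<open>f\<close> from \<open>l\<close>.\<close>

definition order_converges :: "('i \<Rightarrow> 'a::riesz_space) \<Rightarrow> 'a \<Rightarrow> 'i filter \<Rightarrow> bool" where
  "order_converges f l F \<longleftrightarrow>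
     (\<exists>G. decreases_to_zero G \<and> (\<forall>g\<in>G. eventually (\<lambda>i. \<bar>f i - l\<bar> \<le> g) F))"

text \<open>Order convergence of a net depends only on the image of its tail filter in the space,
  so it suffices to quantify over filters on the space itself.\<close>

definition order_continuous :: "('a::riesz_space \<Rightarrow> 'b::riesz_space) \<Rightarrow> bool" where
  "order_continuous T \<longleftrightarrow>
     (\<forall>F l. order_converges (\<lambda>x. x) l F \<longrightarrow> order_converges T (T l) F)"

definition upwards_directed :: "'a::order set \<Rightarrow> bool" where
  "upwards_directed D \<longleftrightarrow> D \<noteq> {} \<and> (\<forall>f\<in>D. \<forall>g\<in>D. \<exists>h\<in>D. f \<le> h \<and> g \<le> h)"

text \<open>The tail filter of an upwards directed set, viewed as a net indexed by itself.\<close>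

definition upward_filter :: "'a::order set \<Rightarrow> 'a filter" where
  "upward_filter D = (INF d\<in>D. principal {x\<in>D. d \<le> x})"

subsection \<open>Riesz homomorphisms and conditional expectations\<close>

definition riesz_hom :: "('a::riesz_space \<Rightarrow> 'b::riesz_space) \<Rightarrow> bool" where
  "riesz_hom S \<longleftrightarrow> linear S \<and> (\<forall>x y. S (sup x y) = sup (S x) (S y)) \<and>
     (\<forall>x y. S (inf x y) = inf (S x) (S y))"

definition dedekind_complete_riesz_subspace :: "'a::riesz_space set \<Rightarrow> bool" where
  "dedekind_complete_riesz_subspace R \<longleftrightarrow> subspace R \<and>
     (\<forall>x\<in>R. \<forall>y\<in>R. sup x y \<in> R \<and> inf x y \<in> R) \<and>
     (\<forall>A\<subseteq>R. A \<noteq> {} \<longrightarrow> (\<exists>u\<in>R. \<forall>a\<in>A. a \<le> u) \<longrightarrow> (\<exists>s. is_lub_in R A s))"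

definition conditional_expectation :: "('a::riesz_space \<Rightarrow> 'a) \<Rightarrow> bool" where
  "conditional_expectation T \<longleftrightarrow> linear T \<and> (\<forall>x\<ge>0. 0 \<le> T x) \<and> order_continuous T \<and>
     (\<forall>x. T (T x) = T x) \<and> (\<forall>u. weak_order_unit u \<longrightarrow> weak_order_unit (T u)) \<and>
     dedekind_complete_riesz_subspace (range T)"

definition strictly_positive :: "('a::riesz_space \<Rightarrow> 'a) \<Rightarrow> bool" where
  "strictly_positive T \<longleftrightarrow> (\<forall>f\<ge>0. T f = 0 \<longrightarrow> f = 0)"

definition ceps ::
  "('a::dedekind_complete_riesz_space \<Rightarrow> 'a) \<Rightarrow> ('a \<Rightarrow> 'a) \<Rightarrow> 'a \<Rightarrow> bool" where
  "ceps T S e \<longleftrightarrow> weak_order_unit e \<and> conditional_expectation T \<and> T e = e \<and>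
     riesz_hom S \<and> order_continuous S \<and> S e = e \<and> (\<forall>f. T (S f) = T f)"

text \<open>This says both that the order limit \<open>L\<^sub>S f\<close> of the Cesaro means exists for
  every \<open>f\<close> and that \<open>L\<^sub>S = T\<close>.\<close>

definition conditionally_ergodic ::
  "('a::dedekind_complete_riesz_space \<Rightarrow> 'a) \<Rightarrow> ('a \<Rightarrow> 'a) \<Rightarrow> bool" where
  "conditionally_ergodic T S \<longleftrightarrow>
     (\<forall>f. order_converges (\<lambda>n. (1 / real n) *\<^sub>R (\<Sum>k<n. (S ^^ k) f)) (T f) sequentially)"

subsection \<open>Universal completeness\<close>

definition laterally_complete :: "'a::riesz_space itself \<Rightarrow> bool" where
  "laterally_complete _ \<longleftrightarrow>
     (\<forall>A::'a set. A \<noteq> {} \<longrightarrow> (\<forall>x\<in>A. 0 \<le> x) \<longrightarrow> (\<forall>x\<in>A. \<forall>y\<in>A. x \<noteq> y \<longrightarrow> disjoint_elems x y) \<longrightarrow>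
        (\<exists>s. is_lub_in UNIV A s))"

text \<open>The universal completion is determined only up to Riesz isomorphism. It is given by
  its embedding \<open>\<iota>\<close>, as an order dense Riesz subspace, into a universally complete
  (that is, Dedekind and laterally complete) space.\<close>

definition universal_completion ::
  "('a::riesz_space \<Rightarrow> 'u::dedekind_complete_riesz_space) \<Rightarrow> bool" where
  "universal_completion \<iota> \<longleftrightarrow> laterally_complete TYPE('u) \<and> riesz_hom \<iota> \<and> inj \<iota> \<and>
     (\<forall>y>0. \<exists>x>0. \<iota> x \<le> y)"

definition T_universally_complete ::
  "('a::riesz_space \<Rightarrow> 'u::dedekind_complete_riesz_space) \<Rightarrow> ('a \<Rightarrow> 'a) \<Rightarrow> bool" where
  "T_universally_complete \<iota> T \<longleftrightarrow>
     (\<forall>D. upwards_directed D \<longrightarrow> (\<forall>f\<in>D. 0 \<le> f) \<longrightarrow> (\<exists>l u. \<forall>f\<in>D. l \<le> \<iota> (T f) \<and> \<iota> (T f) \<le> u) \<longrightarrow>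
        (\<exists>g. order_converges (\<lambda>f. f) g (upward_filter D)))"

end

theory Submission
  imports Defs
begin

text \<open>Since \<open>T\<close> is strictly positive and \<open>T S = T\<close>, the surjective map \<open>S\<close> is an automorphism.
  Write \<open>b\<^sub>k\<close> for the supremum of \<open>p, S\<^sup>-\<^sup>1 p, \<dots>, S\<^sup>-\<^sup>(\<^sup>k\<^sup>-\<^sup>1\<^sup>) p\<close> and \<open>a\<^sub>k = b\<^sub>k\<^sub>+\<^sub>1 - b\<^sub>k\<close>, the points entering \<open>p\<close> for the
  first time after \<open>k\<close> steps. The \<open>a\<^sub>k\<close> are disjoint and \<open>S a\<^sub>k\<^sub>+\<^sub>1 \<le> a\<^sub>k\<close>, so that \<open>T a\<^sub>k\<close>
  decreases. The supremum \<open>b\<close> of the \<open>b\<^sub>k\<close> is \<open>S\<close>-invariant, and ergodicity identifies it with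
  \<open>P\<^sub>T\<^sub>p e\<close>. The sum \<open>q\<close> of the \<open>a\<^sub>k\<close> with \<open>k \<equiv> n - 1\<close> modulo \<open>n\<close> has \<open>n\<close> disjoint iterates, and
  \<open>n T q\<close> dominates the sum of all \<open>T a\<^sub>k\<close> with \<open>k \<ge> n - 1\<close>, which is
  \<open>b - T b\<^sub>n\<^sub>-\<^sub>1 \<ge> b - (n - 1) T p\<close>.\<close>

subsection \<open>Disjointness and components\<close>

lemma inf_eq_0_mono:
  fixes x y :: "'a::riesz_space"
  assumes "inf x y = 0" "0 \<le> x'" "x' \<le> x" "0 \<le> y'" "y' \<le> y"
  shows "inf x' y' = 0"
proof (rule order_antisym)
  show "inf x' y' \<le> 0" using inf_mono[OF assms(3,5)] assms(1) by simp
  show "0 \<le> inf x' y'" using assms(2,4) by (rule inf_greatest)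
qed

text \<open>Distributing \<open>+\<close> over \<open>inf\<close>, the right-hand side is the
  infimum of \<open>x + y\<close>, \<open>x + z\<close>, \<open>z + y\<close> and
  \<open>z + z\<close>, and each of these dominates the left-hand side.\<close>

lemma inf_add_le:
  fixes x y z :: "'a::riesz_space"
  assumes "0 \<le> x" "0 \<le> y" "0 \<le> z"
  shows "inf (x + y) z \<le> inf x z + inf y z"
proof -
  have "inf (x + y) z \<le> inf (inf (x + y) (x + z)) (inf (z + y) (z + z))"
    using assms
    by (intro inf_greatest) (auto intro: le_infI2 add_increasing add_increasing2 inf.coboundedI2)
  also have "\<dots> = inf x z + inf y z"
    by (simp add: add_inf_distrib_left add_inf_distrib_right inf.assoc inf.left_commute inf.commute)
  finally show ?thesis .
qed

lemma inf_add_eq_0: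
  fixes x y z :: "'a::riesz_space"
  assumes "inf x z = 0" "inf y z = 0"
  shows "inf (x + y) z = 0"
proof -
  have *: "0 \<le> x" "0 \<le> y" "0 \<le> z"
    using assms by (metis inf.cobounded1 inf.cobounded2)+
  have "inf (x + y) z \<le> 0"
    using inf_add_le[OF *] assms by simp
  then show ?thesis
    using * by (simp add: order_antisym)
qed

lemma inf_sum_eq_0:
  fixes z :: "'a::riesz_space"
  assumes "\<And>i. i \<in> I \<Longrightarrow> inf (f i) z = 0" "0 \<le> z"
  shows "inf (sum f I) z = 0"
  using assms by (induction I rule: infinite_finite_induct) (auto simp: inf_add_eq_0 inf_absorb1)

lemma add_le_of_inf_eq_0:
  fixes x y u :: "'a::riesz_space"
  assumes "inf x y = 0" "x \<le> u" "y \<le> u"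
  shows "x + y \<le> u"
  using assms add_eq_inf_sup[of x y] by simp

text \<open>Each \<open>a\<close> in \<open>A\<close> is disjoint from \<open>inf s x\<close> and
  both lie below \<open>s\<close>, so their sum does too. Hence \<open>s - inf s x\<close> is again
  an upper bound of \<open>A\<close>.\<close>

lemma inf_lub_eq_0:
  fixes x s :: "'a::riesz_space"
  assumes "is_lub_in UNIV A s" "A \<noteq> {}" "\<And>a. a \<in> A \<Longrightarrow> inf a x = 0"
  shows "inf s x = 0"
proof -
  obtain a where a: "a \<in> A" using assms(2) by blast
  then have "0 \<le> a" "0 \<le> x" "a \<le> s"
    using assms(1,3) unfolding is_lub_in_def by (metis inf.cobounded1 inf.cobounded2)+
  then have w: "0 \<le> inf s x" by simp
  have "a \<le> s - inf s x" if "a \<in> A" for a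
    unfolding le_diff_eq
  proof (rule add_le_of_inf_eq_0)
    have "0 \<le> a" using assms(3)[OF that] by (metis inf.cobounded1)
    then show "inf a (inf s x) = 0"
      by (intro inf_eq_0_mono[OF assms(3)[OF that]]) (use w in auto)
  qed (use assms(1) that in \<open>auto simp: is_lub_in_def\<close>)
  then have "s \<le> s - inf s x"
    using assms(1) unfolding is_lub_in_def by blast
  then have "inf s x \<le> 0"
    by (simp only: le_diff_eq add_le_same_cancel1)
  with w show ?thesis by (simp only: order_antisym)
qed

lemma is_lub_in_cSUP:
  fixes f :: "'b \<Rightarrow> 'a::conditionally_complete_lattice"
  assumes "I \<noteq> {}" "\<And>i. i \<in> I \<Longrightarrow> f i \<le> c"
  shows "is_lub_in UNIV (f ` I) (SUP i\<in>I. f i)"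
  using assms unfolding is_lub_in_def by (auto intro!: cSUP_upper cSUP_least bdd_aboveI2)

text \<open>Both \<open>x\<close> and \<open>y\<close> are disjoint from \<open>e - sup x y\<close>,
  hence so is \<open>x + y\<close>, which dominates \<open>sup x y\<close>.\<close>

lemma component_of_sup:
  assumes "component_of x e" "component_of y e"
  shows "component_of (sup x y) e"
proof -
  have *: "0 \<le> x" "0 \<le> y" "x \<le> e" "y \<le> e" "inf (e - x) x = 0" "inf (e - y) y = 0"
    using assms by (auto simp: component_of_def)
  then have "sup x y \<le> e" by simp
  then have le: "0 \<le> e - sup x y" by (simp only: diff_ge_0_iff_ge)
  have "inf (x + y) (e - sup x y) = 0"
  proof (rule inf_add_eq_0)
    show "inf x (e - sup x y) = 0"
      by (rule inf_eq_0_mono[of x "e - x"]) (use * le in \<open>simp_all add: inf.commute\<close>)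
    show "inf y (e - sup x y) = 0"
      by (rule inf_eq_0_mono[of y "e - y"]) (use * le in \<open>simp_all add: inf.commute\<close>)
  qed
  then have "inf (sup x y) (e - sup x y) = 0"
    by (rule inf_eq_0_mono) (use * le in \<open>simp_all add: le_supI1 add_increasing add_increasing2\<close>)
  then show ?thesis
    using * by (auto simp: component_of_def inf.commute intro: le_supI1)
qed

lemma component_of_lub:
  assumes "is_lub_in UNIV A s" "A \<noteq> {}" "\<And>a. a \<in> A \<Longrightarrow> component_of a e"
  shows "component_of s e"
proof -
  have le: "\<And>a. a \<in> A \<Longrightarrow> a \<le> s" and "s \<le> e"
    using assms(1,3) by (auto simp: is_lub_in_def component_of_def)
  obtain a where "a \<in> A" using assms(2) by blast
  then have "0 \<le> a" "0 \<le> e" "a \<le> s"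
    using assms(3) le by (auto simp: component_of_def)
  then have "0 \<le> s" by order
  have "inf s (e - s) = 0"
  proof (rule inf_lub_eq_0[OF assms(1,2)])
    fix a assume a: "a \<in> A"
    then have "inf a (e - a) = 0" "0 \<le> a"
      using assms(3) by (auto simp: component_of_def inf.commute)
    then show "inf a (e - s) = 0"
      by (rule inf_eq_0_mono) (use le[OF a] \<open>s \<le> e\<close> in \<open>auto simp: diff_left_mono\<close>)
  qed
  then show ?thesis
    using \<open>0 \<le> s\<close> \<open>0 \<le> e\<close> \<open>s \<le> e\<close> by (simp add: component_of_def inf.commute)
qed

text \<open>Write \<open>e - (y - x)\<close> as \<open>(e - y) + x\<close>; each summand is disjoint
  from \<open>y - x\<close>.\<close>

lemma component_of_diff:
  assumes "component_of x e" "component_of y e" "x \<le> y"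
  shows "component_of (y - x) e"
proof -
  have *: "0 \<le> x" "y \<le> e" "inf (e - x) x = 0" "inf (e - y) y = 0" "0 \<le> y" "x \<le> e" "0 \<le> e"
    using assms by (auto simp: component_of_def)
  have "inf ((e - y) + x) (y - x) = 0"
  proof (rule inf_add_eq_0)
    show "inf (e - y) (y - x) = 0"
      by (rule inf_eq_0_mono[of "e - y" y]) (use * assms(3) in auto)
    show "inf x (y - x) = 0"
      by (rule inf_eq_0_mono[of x "e - x"])
        (use * assms(3) in \<open>auto simp: inf.commute diff_right_mono\<close>)
  qed
  moreover have "(e - y) + x = e - (y - x)" by simp
  moreover have "y - x \<le> e"
    using * by (meson diff_le_eq add_increasing2 order_trans)
  ultimately show ?thesis
    using * assms(3) by (simp add: component_of_def)
qed

lemma component_of_subcomponent: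
  assumes "component_of q e" "q \<le> b" "b \<le> e"
  shows "component_of q b"
proof -
  have "inf (b - q) q = 0"
    by (rule inf_eq_0_mono[of "e - q" q])
      (use assms in \<open>auto simp: component_of_def diff_right_mono\<close>)
  then show ?thesis
    using assms by (auto simp: component_of_def intro: order_trans)
qed

subsection \<open>Bands\<close>

lemma subspace_disjoint_complement: "subspace (disjoint_complement {d::'a::riesz_space})"
proof (rule subspaceI)
  show "0 \<in> disjoint_complement {d}"
    by (simp add: disjoint_complement_def disjoint_elems_def inf_absorb1)
next
  fix x y assume "x \<in> disjoint_complement {d}" "y \<in> disjoint_complement {d}"
  then have "inf (\<bar>x\<bar> + \<bar>y\<bar>) \<bar>d\<bar> = 0"
    by (intro inf_add_eq_0) (auto simp: disjoint_complement_def disjoint_elems_def)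
  then have "inf \<bar>x + y\<bar> \<bar>d\<bar> = 0"
    by (rule inf_eq_0_mono) (auto simp: abs_triangle_ineq)
  then show "x + y \<in> disjoint_complement {d}"
    by (simp add: disjoint_complement_def disjoint_elems_def)
next
  fix c :: real and x assume x: "x \<in> disjoint_complement {d}"
  \<comment> \<open>Bounding the scalar by a natural number reduces scaling to a finite sum of
    copies of \<open>\<bar>x\<bar>\<close>.\<close>
  obtain m :: nat where m: "\<bar>c\<bar> \<le> real m" using real_arch_simple by blast
  have "inf (\<Sum>i<m. \<bar>x\<bar>) \<bar>d\<bar> = 0"
    by (rule inf_sum_eq_0) (use x in \<open>auto simp: disjoint_complement_def disjoint_elems_def\<close>)
  moreover have "\<bar>c *\<^sub>R x\<bar> \<le> (\<Sum>i<m. \<bar>x\<bar>)"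
  proof -
    have "c *\<^sub>R x \<le> \<bar>c\<bar> *\<^sub>R \<bar>x\<bar>" for c :: real and x :: 'a
    proof (cases "c \<ge> 0")
      case True
      then show ?thesis using scaleR_left_mono[OF abs_ge_self[of x] True] by simp
    next
      case False
      then have "(-c) *\<^sub>R (-x) \<le> (-c) *\<^sub>R \<bar>x\<bar>"
        by (intro scaleR_left_mono) (auto simp: abs_ge_minus_self)
      then show ?thesis using False by simp
    qed
    from this[of c x] this[of "-c" x] have "\<bar>c *\<^sub>R x\<bar> \<le> \<bar>c\<bar> *\<^sub>R \<bar>x\<bar>"
      by (simp add: abs_leI)
    also have "\<dots> \<le> real m *\<^sub>R \<bar>x\<bar>" using m by (simp add: scaleR_right_mono)
    finally show ?thesis by (simp add: sum_constant_scaleR)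
  qed
  ultimately have "inf \<bar>c *\<^sub>R x\<bar> \<bar>d\<bar> = 0"
    using inf_eq_0_mono abs_ge_zero order_refl by blast
  then show "c *\<^sub>R x \<in> disjoint_complement {d}"
    by (simp add: disjoint_complement_def disjoint_elems_def)
qed

lemma band_disjoint_complement: "band (disjoint_complement {d::'a::riesz_space})"
  unfolding band_def order_ideal_def
proof (intro conjI allI impI)
  show sub: "subspace (disjoint_complement {d})"
    by (rule subspace_disjoint_complement)
  show solid: "x \<in> disjoint_complement {d}"
    if "y \<in> disjoint_complement {d}" "\<bar>x\<bar> \<le> \<bar>y\<bar>" for x y
    using that inf_eq_0_mono[of "\<bar>y\<bar>" "\<bar>d\<bar>" "\<bar>x\<bar>" "\<bar>d\<bar>"]
    by (auto simp: disjoint_complement_def disjoint_elems_def)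
  fix A s assume A: "A \<subseteq> disjoint_complement {d}" and s: "is_lub_in UNIV A s"
  show "s \<in> disjoint_complement {d}"
  proof (cases "A = {}")
    case True
    \<comment> \<open>With \<open>A\<close> empty every element is an upper bound, so
      \<open>s\<close> would be a least element of the space.\<close>
    then have "s \<le> s - \<bar>s\<bar>" using s unfolding is_lub_in_def by blast
    then have "s = 0" by simp
    then show ?thesis using sub by (simp add: subspace_0)
  next
    case False
    then obtain a0 where a0: "a0 \<in> A" by blast
    \<comment> \<open>Elements of \<open>A\<close> may be negative. Joining with \<open>a0\<close>
      and then shifting by it makes the family positive, with supremum
      \<open>s - a0\<close>.\<close>
    let ?A = "(\<lambda>a. sup a a0 - a0) ` A"
    have lub: "is_lub_in UNIV ?A (s - a0)"
      unfolding is_lub_in_def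
    proof (intro conjI ballI impI)
      fix x assume "x \<in> ?A"
      then show "x \<le> s - a0"
        using s a0 by (auto simp: is_lub_in_def intro: diff_right_mono)
    next
      fix u assume u: "\<forall>x\<in>?A. x \<le> u"
      have "a \<le> u + a0" if "a \<in> A" for a
        using u that by (auto simp: diff_le_eq)
      then show "s - a0 \<le> u"
        using s by (auto simp: is_lub_in_def diff_le_eq)
    qed simp
    have "inf (s - a0) \<bar>d\<bar> = 0"
    proof (rule inf_lub_eq_0[OF lub])
      fix x assume "x \<in> ?A"
      then obtain a where a: "a \<in> A" "x = sup a a0 - a0" by blast
      have "0 \<le> x" using a by simp
      have "x = sup (a - a0) 0"
        using a by (simp add: add_sup_distrib_right diff_conv_add_uminus del: add_uminus_conv_diff)
      also have "\<dots> \<le> \<bar>a - a0\<bar>" by (intro sup_least abs_ge_self abs_ge_zero)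
      finally have "\<bar>x\<bar> \<le> \<bar>a - a0\<bar>" using \<open>0 \<le> x\<close> by simp
      moreover have "a - a0 \<in> disjoint_complement {d}"
        using A a a0 sub by (auto intro: subspace_diff)
      ultimately have "x \<in> disjoint_complement {d}" using solid by blast
      then show "inf x \<bar>d\<bar> = 0"
        using \<open>0 \<le> x\<close> by (simp add: disjoint_complement_def disjoint_elems_def)
    qed (use False in simp)
    moreover have "0 \<le> s - a0" using s a0 by (auto simp: is_lub_in_def)
    ultimately have "s - a0 \<in> disjoint_complement {d}"
      by (simp add: disjoint_complement_def disjoint_elems_def)
    then have "(s - a0) + a0 \<in> disjoint_complement {d}"
      using A a0 sub by (blast intro: subspace_add)
    then show ?thesis by simp
  qed
qed

lemma mem_band_generated: "f \<in> band_generated f"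
  by (simp add: band_generated_def)

lemma band_band_generated: "band (band_generated f)"
  unfolding band_def order_ideal_def
proof (intro conjI allI impI)
  show "subspace (band_generated f)"
    unfolding band_generated_def
    by (rule subspace_Inter) (auto simp: band_def order_ideal_def)
  show "x \<in> band_generated f" if "y \<in> band_generated f" "\<bar>x\<bar> \<le> \<bar>y\<bar>" for x y
    using that unfolding band_generated_def band_def order_ideal_def by blast
  show "s \<in> band_generated f" if "A \<subseteq> band_generated f" "is_lub_in UNIV A s" for A s
    using that unfolding band_generated_def band_def by blast
qed

text \<open>Uniqueness for the description operator: two candidates differ by an element of the band
  that is also disjoint from itself, hence zero.\<close>

lemma band_proj_eqI:
  fixes f x c :: "'a::dedekind_complete_riesz_space"
  assumes "c \<in> band_generated f" "x - c \<in> disjoint_complement (band_generated f)"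
  shows "band_proj f x = c"
  unfolding band_proj_def
proof (rule the_equality)
  fix b assume b: "b \<in> band_generated f \<and> x - b \<in> disjoint_complement (band_generated f)"
  let ?z = "(x - b) - (x - c)"
  have "c - b \<in> band_generated f"
    using band_band_generated[of f] b assms(1)
    by (auto simp: band_def order_ideal_def intro: subspace_diff)
  then have z: "?z \<in> band_generated f" by simp
  then have "x - b \<in> disjoint_complement {?z}" "x - c \<in> disjoint_complement {?z}"
    using b assms(2) by (auto simp: disjoint_complement_def)
  then have "?z \<in> disjoint_complement {?z}"
    by (rule subspace_diff[OF subspace_disjoint_complement])
  then have "\<bar>?z\<bar> = 0"
    unfolding disjoint_complement_def disjoint_elems_def inf.idem by simp
  then show "b = c" by simp
qed (use assms in simp)

text \<open>\<open>w\<close> is the classical formula for the projection of \<open>e\<close> onto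
  the band of \<open>h\<close>. For the disjointness, adding \<open>inf (e - w) h\<close> to the
  truncation with index \<open>m\<close> stays below the one with index \<open>m + 1\<close>, so
  \<open>w - inf (e - w) h\<close> is still an upper bound.\<close>

lemma SUP_multiples_in_band:
  fixes e h :: "'a::dedekind_complete_riesz_space"
  assumes "0 \<le> e" "0 \<le> h"
  defines "w \<equiv> (SUP m. inf e (real m *\<^sub>R h))"
  shows "w \<in> band_generated h" "w \<le> e" "inf (e - w) h = 0"
proof -
  have lub: "is_lub_in UNIV (range (\<lambda>m. inf e (real m *\<^sub>R h))) w"
    unfolding w_def by (rule is_lub_in_cSUP[where c = e]) auto
  have "inf e (real m *\<^sub>R h) \<in> band_generated h" for m
  proof -
    have "real m *\<^sub>R h \<in> band_generated h"
      using band_band_generated[of h] mem_band_generated[of h]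
      by (auto simp: band_def order_ideal_def intro: subspace_scale)
    moreover have "\<bar>inf e (real m *\<^sub>R h)\<bar> \<le> \<bar>real m *\<^sub>R h\<bar>"
      using assms by (simp add: scaleR_nonneg_nonneg)
    ultimately show ?thesis
      using band_band_generated[of h] by (auto simp: band_def order_ideal_def)
  qed
  then have "range (\<lambda>m. inf e (real m *\<^sub>R h)) \<subseteq> band_generated h"
    by blast
  with lub show "w \<in> band_generated h"
    using band_band_generated[of h] unfolding band_def by blast
  show "w \<le> e" using lub by (auto simp: is_lub_in_def)
  let ?z = "inf (e - w) h"
  have "inf e (real m *\<^sub>R h) + ?z \<le> w" for m
  proof -
    have "inf e (real m *\<^sub>R h) \<le> w" using lub by (auto simp: is_lub_in_def)
    then have "inf e (real m *\<^sub>R h) + ?z \<le> w + (e - w)"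
      by (intro add_mono) auto
    moreover have "inf e (real m *\<^sub>R h) + ?z \<le> real m *\<^sub>R h + h"
      by (intro add_mono) auto
    ultimately have "inf e (real m *\<^sub>R h) + ?z \<le> inf e (real (Suc m) *\<^sub>R h)"
      by (simp add: algebra_simps)
    also have "\<dots> \<le> w" using lub unfolding is_lub_in_def by blast
    finally show ?thesis .
  qed
  then have "inf e (real m *\<^sub>R h) \<le> w - ?z" for m
    by (simp only: le_diff_eq)
  then have "w \<le> w - ?z"
    using lub unfolding is_lub_in_def by blast
  then have "?z \<le> 0" by (simp only: le_diff_eq add_le_same_cancel1)
  then show "?z = 0"
    using \<open>w \<le> e\<close> assms(2) by (simp add: order_antisym)
qed

subsection \<open>Order limits\<close>

lemma le_of_le_decreases_to_zero:
  assumes "decreases_to_zero G" "\<And>g. g \<in> G \<Longrightarrow> x \<le> y + g"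
  shows "x \<le> y"
proof -
  have "x - y \<le> g" if "g \<in> G" for g
    using assms(2)[OF that] by (simp add: algebra_simps)
  then have "x - y \<le> 0"
    using assms(1) unfolding decreases_to_zero_def by blast
  then show ?thesis by simp
qed

lemma order_continuous_lub_le:
  fixes T :: "'a::riesz_space \<Rightarrow> 'b::riesz_space" and x :: "nat \<Rightarrow> 'a"
  assumes "order_continuous T" "incseq x" "is_lub_in UNIV (range x) s" "\<And>i. T (x i) \<le> c"
  shows "T s \<le> c"
proof -
  have le: "x i \<le> s" for i using assms(3) by (auto simp: is_lub_in_def)
  have "decreases_to_zero (range (\<lambda>i. s - x i))"
    unfolding decreases_to_zero_def
  proof (intro conjI ballI allI impI)
    fix g h assume "g \<in> range (\<lambda>i. s - x i)" "h \<in> range (\<lambda>i. s - x i)"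
    then obtain i j where "g = s - x i" "h = s - x j" by blast
    then have "s - x (max i j) \<le> g" "s - x (max i j) \<le> h"
      using incseqD[OF assms(2)] by (auto intro: diff_left_mono)
    then show "\<exists>k\<in>range (\<lambda>i. s - x i). k \<le> g \<and> k \<le> h" by blast
  next
    fix z assume "\<forall>g\<in>range (\<lambda>i. s - x i). z \<le> g"
    then have "x i \<le> s - z" for i by (auto simp: algebra_simps)
    then have "s \<le> s - z"
      using assms(3) unfolding is_lub_in_def by blast
    then show "z \<le> 0" by simp
  qed (use le in auto)
  moreover have "\<forall>\<^sub>F i in sequentially. \<bar>x i - s\<bar> \<le> s - x j" for j
    using eventually_ge_at_top[of j]
  proof eventually_elim
    case (elim i)
    have "\<bar>x i - s\<bar> = s - x i" using le[of i] by (simp add: abs_minus_commute)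
    then show ?case using incseqD[OF assms(2) elim] by (simp add: diff_left_mono)
  qed
  \<comment> \<open>Order continuity is phrased for filters on the space, so the sequence enters
    through its image filter.\<close>
  ultimately have "order_converges (\<lambda>x. x) s (filtermap x sequentially)"
    unfolding order_converges_def eventually_filtermap by blast
  then have "order_converges T (T s) (filtermap x sequentially)"
    using assms(1) by (simp add: order_continuous_def)
  then obtain G where G: "decreases_to_zero G"
    and ev: "\<And>g. g \<in> G \<Longrightarrow> \<forall>\<^sub>F i in sequentially. \<bar>T (x i) - T s\<bar> \<le> g"
    unfolding order_converges_def eventually_filtermap by blast
  show ?thesis
  proof (rule le_of_le_decreases_to_zero[OF G])
    fix g assume "g \<in> G"
    then obtain i where i: "\<bar>T (x i) - T s\<bar> \<le> g"
      using ev by (meson eventually_happens sequentially_bot)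
    have "T s - T (x i) \<le> g"
      using i abs_ge_self[of "T s - T (x i)"] by (simp add: abs_minus_commute order_trans)
    then have "T s \<le> T (x i) + g" by (simp add: algebra_simps)
    also have "\<dots> \<le> c + g" using assms(4) by (simp add: add_right_mono)
    finally show "T s \<le> c + g" .
  qed
qed

lemma order_converges_constant:
  assumes "order_converges f l F" "\<forall>\<^sub>F i in F. f i = c" "F \<noteq> bot"
  shows "l = c"
proof -
  obtain G where G: "decreases_to_zero G"
    and ev: "\<And>g. g \<in> G \<Longrightarrow> \<forall>\<^sub>F i in F. \<bar>f i - l\<bar> \<le> g"
    using assms(1) unfolding order_converges_def by blast
  have "\<bar>c - l\<bar> \<le> 0"
  proof (rule le_of_le_decreases_to_zero[OF G])
    fix g assume "g \<in> G"
    from ev[OF this] assms(2) have "\<forall>\<^sub>F i in F. \<bar>c - l\<bar> \<le> g"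
      by eventually_elim simp
    then show "\<bar>c - l\<bar> \<le> 0 + g" using assms(3) by (simp add: eventually_const)
  qed
  then show ?thesis by simp
qed

subsection \<open>Conditional expectation preserving automorphisms\<close>

lemma riesz_hom_mono: "riesz_hom S \<Longrightarrow> x \<le> y \<Longrightarrow> S x \<le> S y"
  by (metis riesz_hom_def le_iff_inf)

lemma riesz_hom_funpow:
  fixes S :: "'a::riesz_space \<Rightarrow> 'a"
  assumes "riesz_hom S"
  shows "riesz_hom (S ^^ k)"
proof (induction k)
  case 0
  show ?case by (simp add: riesz_hom_def linear_iff)
next
  case (Suc k)
  then show ?case
    using assms linear_compose[of "S ^^ k" S] by (simp add: riesz_hom_def comp_def)
qed

lemma riesz_hom_inv:
  assumes "riesz_hom S" "bij S"
  shows "riesz_hom (inv S)"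
proof -
  have S: "linear S" "\<And>x y. S (sup x y) = sup (S x) (S y)" "\<And>x y. S (inf x y) = inf (S x) (S y)"
    using assms(1) by (auto simp: riesz_hom_def)
  have eq: "inv S y = x" if "S x = y" for x y
    using assms(2) that by (simp add: bij_is_inj inv_f_eq)
  have SR: "S (inv S y) = y" for y
    using assms(2) by (simp add: bij_is_surj surj_f_inv_f)
  show ?thesis
    unfolding riesz_hom_def
    by (auto intro!: linearI eq simp: S SR linear_add[OF S(1)] linear_scale[OF S(1)])
qed

text \<open>With \<open>R = S\<^sup>-\<^sup>1\<close>, this is the supremum of \<open>R\<^sup>i p\<close> over \<open>i < k\<close>.\<close>

primrec orbit_sup :: "('a::riesz_space \<Rightarrow> 'a) \<Rightarrow> 'a \<Rightarrow> nat \<Rightarrow> 'a" where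
  "orbit_sup R p 0 = 0"
| "orbit_sup R p (Suc k) = sup p (R (orbit_sup R p k))"

locale ceps_automorphism =
  fixes T S :: "'a::dedekind_complete_riesz_space \<Rightarrow> 'a" and e p :: 'a
  assumes ceps: "ceps T S e"
    and ergodic: "conditionally_ergodic T S"
    and strict: "strictly_positive T"
    and surj: "surj S"
    and p: "component_of p e"
begin

abbreviation "R \<equiv> inv S"

abbreviation "b \<equiv> orbit_sup R p"

definition "a k = b (Suc k) - b k"

definition "orb = (SUP k. b k)"

lemma linear_T: "linear T" and T_e [simp]: "T e = e" and T_S [simp]: "T (S x) = T x"
  and T_nonneg: "0 \<le> x \<Longrightarrow> 0 \<le> T x" and order_continuous_T: "order_continuous T"
  and T_T [simp]: "T (T x) = T x"
  and riesz_S: "riesz_hom S" and linear_S: "linear S" and S_e [simp]: "S e = e"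
  using ceps by (auto simp: ceps_def conditional_expectation_def riesz_hom_def)

lemma T_mono: "x \<le> y \<Longrightarrow> T x \<le> T y"
  using T_nonneg[of "y - x"] by (simp add: linear_diff[OF linear_T])

text \<open>This upgrades a one-sided invariance to equality: \<open>T (y - x)\<close> vanishes, and
  \<open>T\<close> is strictly positive.\<close>

lemma eq_of_T_le:
  assumes "x \<le> y" "T y \<le> T x"
  shows "x = y"
proof -
  have "T (y - x) = 0"
    using assms T_mono[of x y] by (simp add: linear_diff[OF linear_T])
  moreover have "0 \<le> y - x" using assms(1) by simp
  ultimately have "y - x = 0" using strict unfolding strictly_positive_def by blast
  then show ?thesis by simp
qed

text \<open>A Riesz homomorphism commutes with the modulus, so \<open>S x = 0\<close> gives
  \<open>T \<bar>x\<bar> = T (S \<bar>x\<bar>) = 0\<close>, and strict positivity gives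
  injectivity.\<close>

lemma bij_S: "bij S"
proof (rule bijI[OF _ surj])
  show "inj S"
  proof (rule linear_injective_0[OF linear_S, THEN iffD2], intro allI impI)
    fix x assume "S x = 0"
    moreover have "S \<bar>x\<bar> = sup (S x) (- S x)"
      using riesz_S by (simp add: abs_lattice riesz_hom_def linear_neg)
    ultimately have "T \<bar>x\<bar> = 0"
      using T_S[of "\<bar>x\<bar>"] linear_0[OF linear_T] by simp
    then have "\<bar>x\<bar> = 0"
      using strict abs_ge_zero unfolding strictly_positive_def by blast
    then show "x = 0" by simp
  qed
qed

lemma S_R [simp]: "S (R x) = x"
  by (rule surj_f_inv_f[OF surj])

lemma R_S [simp]: "R (S x) = x"
  by (rule inv_f_f[OF bij_is_inj[OF bij_S]])

lemma T_R [simp]: "T (R x) = T x"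
  using T_S[of "R x"] by simp

lemma R_e [simp]: "R e = e"
  using R_S[of e] by simp

lemma riesz_R: "riesz_hom R" and linear_R: "linear R"
  using riesz_hom_inv[OF riesz_S bij_S] by (auto simp: riesz_hom_def)

lemma component_of_R:
  assumes "component_of x e"
  shows "component_of (R x) e"
proof -
  have R_0: "R 0 = 0" by (rule linear_0[OF linear_R])
  have "inf (e - R x) (R x) = R (inf (e - x) x)"
    using riesz_R by (simp add: riesz_hom_def linear_diff)
  then show ?thesis
    using assms R_0 riesz_hom_mono[OF riesz_R, of 0 x] riesz_hom_mono[OF riesz_R, of x e]
    by (simp add: component_of_def)
qed

section \<open>First-entry pieces of the component \<open>p\<close>\<close>

lemma e_nonneg: "0 \<le> e" and p_nonneg: "0 \<le> p"
  using p by (auto simp: component_of_def)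

lemma component_of_b: "component_of (b k) e"
proof (induction k)
  case 0
  then show ?case using e_nonneg by (simp add: component_of_def inf_absorb2)
qed (simp add: component_of_sup component_of_R p)

lemma b_nonneg: "0 \<le> b k" and b_le_e: "b k \<le> e"
  using component_of_b by (auto simp: component_of_def)

lemma b_le_Suc: "b k \<le> b (Suc k)"
proof (induction k)
  case (Suc k)
  from riesz_hom_mono[OF riesz_R this] show ?case by (auto intro: le_supI2)
qed (simp add: p_nonneg le_supI1)

lemma incseq_b: "incseq b"
  using b_le_Suc by (rule incseq_SucI)

lemma a_nonneg: "0 \<le> a k"
  using b_le_Suc by (simp add: a_def)

lemma component_of_a: "component_of (a k) e"
  unfolding a_def by (intro component_of_diff component_of_b b_le_Suc)

lemma sum_a: "(\<Sum>i<k. a (m + i)) = b (m + k) - b m"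
  by (induction k) (simp_all add: a_def)

text \<open>For \<open>i < j\<close> the component \<open>b j\<close> separates the two:
  \<open>a i\<close> lies below \<open>b j\<close>, and \<open>a j\<close> below
  \<open>e - b j\<close>.\<close>

lemma inf_a_a:
  assumes "i \<noteq> j"
  shows "inf (a i) (a j) = 0"
proof -
  have *: "inf (a i) (a j) = 0" if "i < j" for i j
  proof (rule inf_eq_0_mono[of "b j" "e - b j"])
    show "inf (b j) (e - b j) = 0"
      using component_of_b by (simp add: component_of_def inf.commute)
    show "a i \<le> b j"
      using b_nonneg[of i] incseqD[OF incseq_b, of "Suc i" j] that
      by (simp add: a_def diff_le_eq add_increasing2 del: orbit_sup.simps)
    show "a j \<le> e - b j"
      using b_le_e by (simp add: a_def del: orbit_sup.simps)
  qed (simp_all add: a_nonneg)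
  show ?thesis
    using *[of i j] *[of j i] assms by (cases "i < j") (auto simp: inf.commute)
qed

text \<open>Since \<open>S\<close> maps \<open>b (Suc j)\<close> to \<open>sup (S p) (b j)\<close>,
  the left-hand side is the increment of \<open>b\<close> at \<open>k\<close> after joining with
  \<open>S p\<close>, and joining with a fixed element does not enlarge increments.\<close>

lemma S_a_le: "S (a (Suc k)) \<le> a k"
proof -
  have Sb: "S (b (Suc j)) = sup (S p) (b j)" for j
    using riesz_S by (simp add: riesz_hom_def)
  have "sup (S p) (b (Suc k)) \<le> sup (S p) (b k) + a k"
  proof (rule sup_least)
    show "S p \<le> sup (S p) (b k) + a k"
      using a_nonneg[of k] by (simp add: add_increasing2)
    have "b (Suc k) = b k + a k" by (simp add: a_def)
    also have "\<dots> \<le> sup (S p) (b k) + a k" by (intro add_right_mono sup_ge2)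
    finally show "b (Suc k) \<le> sup (S p) (b k) + a k" .
  qed
  then show ?thesis
    unfolding a_def[of "Suc k"] linear_diff[OF linear_S] Sb diff_le_eq
    by (simp only: add.commute)
qed

lemma S_pow_a_le: "(S ^^ i) (a (k + i)) \<le> a k"
proof (induction i)
  case (Suc i)
  have "(S ^^ i) (S (a (Suc (k + i)))) \<le> (S ^^ i) (a (k + i))"
    using riesz_hom_mono[OF riesz_hom_funpow[OF riesz_S]] S_a_le by blast
  with Suc show ?case by (simp add: funpow_swap1)
qed simp

lemma T_S_pow [simp]: "T ((S ^^ i) x) = T x"
  by (induction i) simp_all

lemma T_a_antimono: "T (a (k + i)) \<le> T (a k)"
  using T_mono[OF S_pow_a_le[of i k]] by simp

section \<open>The invariant supremum and the band generated by \<open>T p\<close>\<close>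

lemma lub_orb: "is_lub_in UNIV (range b) orb"
  unfolding orb_def by (rule is_lub_in_cSUP) (auto intro: b_le_e)

lemma component_of_orb: "component_of orb e"
  by (rule component_of_lub[OF lub_orb]) (auto intro: component_of_b)

lemma b_le_orb: "b k \<le> orb"
  using lub_orb by (auto simp: is_lub_in_def)

text \<open>Strict positivity turns \<open>R orb \<le> orb\<close> into equality, so the Cesaro means of \<open>orb\<close> are
  constant.\<close>

lemma T_orb: "T orb = orb"
proof -
  have "b k \<le> S orb" for k
  proof -
    have "R (b k) \<le> orb"
      using b_le_orb[of "Suc k"] by simp
    from riesz_hom_mono[OF riesz_S this] show ?thesis by simp
  qed
  then have "orb \<le> S orb"
    using lub_orb by (auto simp: is_lub_in_def)
  then have S_orb: "S orb = orb"
    using eq_of_T_le[of orb "S orb"] by simp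
  have "(S ^^ k) orb = orb" for k
    by (induction k) (simp_all add: S_orb)
  \<comment> \<open>The index 0 is excluded because the mean there is 0, as
    \<open>1 / 0 = 0\<close>.\<close>
  then have "\<forall>\<^sub>F n in sequentially. (1 / real n) *\<^sub>R (\<Sum>k<n. (S ^^ k) orb) = orb"
    by (intro eventually_mono[OF eventually_gt_at_top[of 0]]) (simp add: sum_constant_scaleR)
  then show ?thesis
    using ergodic order_converges_constant sequentially_bot
    unfolding conditionally_ergodic_def by blast
qed

text \<open>If \<open>w\<close> denotes the right-hand side of the inequality, then \<open>e - w\<close> is fixed by \<open>T\<close> because
  the range of \<open>T\<close> is a sublattice; hence \<open>T (inf p (e - w)) \<le> inf (T p) (e - w) = 0\<close>.\<close>

lemma orb_le_SUP_multiples: "orb \<le> (SUP m. inf e (real m *\<^sub>R T p))"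
proof -
  let ?w = "\<lambda>m::nat. inf e (real m *\<^sub>R T p)"
  define w where "w = (SUP m. ?w m)"
  have Tp: "0 \<le> T p" by (rule T_nonneg[OF p_nonneg])
  note w = SUP_multiples_in_band[OF e_nonneg Tp, folded w_def]
  have lub: "is_lub_in UNIV (range ?w) w"
    unfolding w_def by (rule is_lub_in_cSUP[where c = e]) auto
  have "?w m \<in> range T" for m
  proof -
    have "e \<in> range T" by (metis T_e rangeI)
    moreover have "real m *\<^sub>R T p \<in> range T"
      by (metis linear_scale[OF linear_T] rangeI)
    ultimately show ?thesis
      using ceps unfolding ceps_def conditional_expectation_def dedekind_complete_riesz_subspace_def
      by blast
  qed
  then have T_w: "T (?w m) = ?w m" for m
    using T_T by (metis imageE)
  have "w \<le> T w"
    using lub T_mono[of "?w _" w] T_w by (auto simp: is_lub_in_def)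
  moreover have "T w \<le> w"
  proof (rule order_continuous_lub_le[OF order_continuous_T _ lub])
    show "incseq ?w"
      using Tp by (auto intro!: monoI inf_mono scaleR_right_mono)
    show "T (?w i) \<le> w" for i
      using lub T_w by (auto simp: is_lub_in_def)
  qed
  ultimately have "T (e - w) = e - w"
    by (simp add: linear_diff[OF linear_T])
  \<comment> \<open>Stated for every positive \<open>x\<close> with the same image as
    \<open>p\<close>, so that it applies to all iterates of \<open>p\<close> under
    \<open>R\<close>.\<close>
  then have disj: "inf x (e - w) = 0" if "0 \<le> x" "T x = T p" for x
  proof -
    have "T (inf x (e - w)) \<le> inf (e - w) (T p)"
      using T_mono[of "inf x (e - w)" x] T_mono[of "inf x (e - w)" "e - w"] that
        \<open>T (e - w) = e - w\<close> by simp
    moreover have "0 \<le> inf x (e - w)" using that w(2) by simp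
    ultimately show ?thesis
      using w(3) T_nonneg strict by (metis order_antisym strictly_positive_def)
  qed
  have "0 \<le> w"
    using lub inf_absorb2[OF e_nonneg] by (auto simp: is_lub_in_def dest: spec[of _ 0])
  \<comment> \<open>The disjoint elements \<open>x\<close> and \<open>e - w\<close> both lie below
    \<open>e\<close>, hence so does their sum, which means \<open>x \<le> w\<close>.\<close>
  have le: "x \<le> w" if "0 \<le> x" "x \<le> e" "T x = T p" for x
    using add_le_of_inf_eq_0[OF disj[OF that(1,3)] that(2)] \<open>0 \<le> w\<close> by (simp add: algebra_simps)
  have le_pow: "(R ^^ i) p \<le> w" for i
  proof (rule le)
    have "component_of ((R ^^ i) p) e"
      by (induction i) (simp_all add: p component_of_R)
    then show "0 \<le> (R ^^ i) p" "(R ^^ i) p \<le> e"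
      by (auto simp: component_of_def)
    show "T ((R ^^ i) p) = T p"
      by (induction i) simp_all
  qed
  \<comment> \<open>The exponent must stay arbitrary: unfolding \<open>b (Suc k)\<close> under
    \<open>R ^^ i\<close> leaves \<open>b k\<close> under \<open>R ^^ Suc i\<close>.\<close>
  have "(R ^^ i) (b k) \<le> w" for i k
  proof (induction k arbitrary: i)
    case 0
    have "(R ^^ i) 0 = 0"
      using riesz_hom_funpow[OF riesz_R] by (simp add: riesz_hom_def linear_0)
    with \<open>0 \<le> w\<close> show ?case by simp
  next
    case (Suc k)
    have "(R ^^ i) (b (Suc k)) = sup ((R ^^ i) p) ((R ^^ Suc i) (b k))"
      using riesz_hom_funpow[OF riesz_R, of i] by (simp add: riesz_hom_def funpow_swap1)
    with Suc[of "Suc i"] le_pow[of i] show ?case by simp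
  qed
  from this[of 0] show ?thesis
    using lub_orb by (auto simp: is_lub_in_def w_def)
qed

text \<open>\<open>orb\<close> is in the band because it lies below a supremum of truncated
  multiples of \<open>T p\<close>. Conversely \<open>T p \<le> T orb = orb\<close> makes
  \<open>T p\<close> disjoint from \<open>e - orb\<close>, and the disjoint complement of
  \<open>e - orb\<close> is a band.\<close>

lemma band_proj_eq_orb: "band_proj (T p) e = orb"
proof (rule band_proj_eqI)
  have Tp: "0 \<le> T p" by (rule T_nonneg[OF p_nonneg])
  have orb: "0 \<le> orb" "orb \<le> e" "inf orb (e - orb) = 0"
    using component_of_orb by (auto simp: component_of_def inf.commute)
  let ?w = "SUP m. inf e (real m *\<^sub>R T p)"
  have "?w \<in> band_generated (T p)"
    by (rule SUP_multiples_in_band(1)[OF e_nonneg Tp])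
  moreover have "\<bar>orb\<bar> \<le> \<bar>?w\<bar>"
    using orb_le_SUP_multiples orb(1) by (simp add: order_trans[OF _ abs_ge_self])
  ultimately show "orb \<in> band_generated (T p)"
    using band_band_generated[of "T p"] unfolding band_def order_ideal_def by blast
  have "p \<le> orb"
    using b_le_orb[of "Suc 0"] linear_0[OF linear_R] p_nonneg by (simp add: sup_absorb1)
  then have "T p \<le> orb"
    using T_mono T_orb by metis
  then have "T p \<in> disjoint_complement {e - orb}"
    using inf_eq_0_mono[OF orb(3) Tp] orb(2) Tp
    by (simp add: disjoint_complement_def disjoint_elems_def)
  then have "band_generated (T p) \<subseteq> disjoint_complement {e - orb}"
    using band_disjoint_complement by (auto simp: band_generated_def)
  then show "e - orb \<in> disjoint_complement (band_generated (T p))"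
    by (auto simp: disjoint_complement_def disjoint_elems_def inf.commute)
qed

section \<open>The tower base and its disjoint iterates\<close>

definition "tower_sum n J = (\<Sum>j<J. a (j * n + (n - 1)))"

text \<open>The supremum of the increasing partial sums stands for an infinite disjoint sum.
  Starting at index \<open>n - 1\<close> leaves room to lower each index by up to
  \<open>n - 1\<close>.\<close>

definition "tower_base n = (SUP J. tower_sum n J)"

text \<open>The last index used is \<open>J * n - 1\<close>; adding \<open>a k\<close> to something
  below \<open>b k\<close> gives something below \<open>b (Suc k)\<close>.\<close>

lemma tower_sum_le:
  assumes "n \<ge> 1"
  shows "tower_sum n J \<le> b (J * n)"
proof (induction J)
  case (Suc J)
  have "tower_sum n J \<le> b (J * n + (n - 1))"
    using Suc incseqD[OF incseq_b] by (meson le_add1 order_trans)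
  then have "tower_sum n (Suc J) \<le> b (Suc (J * n + (n - 1)))"
    by (simp add: tower_sum_def a_def le_diff_eq diff_le_eq del: orbit_sup.simps)
  then show ?case using assms by (simp add: add.commute del: orbit_sup.simps)
qed (simp add: tower_sum_def)

text \<open>Each summand is disjoint from its own complement in \<open>e\<close>, hence from the
  smaller \<open>e - ?s\<close>; disjointness then passes to the sum.\<close>

lemma component_of_tower_sum:
  assumes "n \<ge> 1"
  shows "component_of (tower_sum n J) e"
proof -
  let ?s = "tower_sum n J"
  have "?s \<le> e"
    using tower_sum_le[OF assms] b_le_e by (rule order_trans)
  then have nonneg: "0 \<le> e - ?s" by (simp only: diff_ge_0_iff_ge)
  have "inf (\<Sum>j<J. a (j * n + (n - 1))) (e - ?s) = 0"
  proof (rule inf_sum_eq_0[OF _ nonneg])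
    fix j assume "j \<in> {..<J}"
    then have "a (j * n + (n - 1)) \<le> ?s"
      using sum_mono2[of "{..<J}" "{j}" "\<lambda>j. a (j * n + (n - 1))"]
      by (simp add: tower_sum_def a_nonneg)
    then have "e - ?s \<le> e - a (j * n + (n - 1))" by (rule diff_left_mono)
    moreover have "inf (a (j * n + (n - 1))) (e - a (j * n + (n - 1))) = 0"
      using component_of_a by (simp add: component_of_def inf.commute)
    ultimately show "inf (a (j * n + (n - 1))) (e - ?s) = 0"
      using inf_eq_0_mono a_nonneg nonneg order_refl by blast
  qed
  then have "inf (e - ?s) ?s = 0"
    by (simp only: tower_sum_def inf.commute)
  moreover have "0 \<le> ?s"
    unfolding tower_sum_def by (intro sum_nonneg a_nonneg)
  ultimately show ?thesis
    using e_nonneg \<open>?s \<le> e\<close> by (simp only: component_of_def simp_thms)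
qed

lemma lub_tower_base:
  assumes "n \<ge> 1"
  shows "is_lub_in UNIV (range (tower_sum n)) (tower_base n)"
  unfolding tower_base_def
  by (rule is_lub_in_cSUP[where c = e])
    (use component_of_tower_sum[OF assms] in \<open>auto simp: component_of_def\<close>)

lemma component_of_tower_base:
  assumes "n \<ge> 1"
  shows "component_of (tower_base n) e"
  by (rule component_of_lub[OF lub_tower_base[OF assms]])
    (auto intro: component_of_tower_sum[OF assms])

lemma tower_base_le_orb:
  assumes "n \<ge> 1"
  shows "tower_base n \<le> orb"
proof -
  have "tower_sum n J \<le> orb" for J
    using tower_sum_le[OF assms] b_le_orb by (rule order_trans)
  then show ?thesis
    using lub_tower_base[OF assms] unfolding is_lub_in_def by blast
qed

text \<open>Reduces disjointness from the base to disjointness from its single pieces, through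
  finite sums and the supremum.\<close>

lemma inf_tower_base_eq_0:
  assumes "n \<ge> 1" "\<And>j. inf (a (j * n + (n - 1))) x = 0"
  shows "inf (tower_base n) x = 0"
proof (rule inf_lub_eq_0[OF lub_tower_base[OF assms(1)]])
  have "0 \<le> x" using assms(2) by (metis inf.cobounded2)
  then show "inf y x = 0" if "y \<in> range (tower_sum n)" for y
    using that assms(2) by (auto simp: tower_sum_def intro: inf_sum_eq_0)
qed simp

lemma S_pow_tower_base_disjoint:
  assumes "n \<ge> 1" "0 < d" "d < n"
  shows "inf (tower_base n) ((S ^^ d) (tower_base n)) = 0"
proof (rule inf_tower_base_eq_0[OF assms(1)])
  fix j
  let ?k = "j * n + (n - 1)"
  have hom: "riesz_hom (S ^^ d)" by (rule riesz_hom_funpow[OF riesz_S])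
  then have lin: "linear (S ^^ d)" by (simp add: riesz_hom_def)
  have surj_d: "surj (S ^^ d)" using surj by (rule surj_fn)
  \<comment> \<open>Pulling the piece back by \<open>S ^^ d\<close> leaves the unshifted base on the
    other side, so the piecewise criterion applies a second time.\<close>
  then obtain x where x: "(S ^^ d) x = a ?k" by (metis surjD)
  have inj_d: "inj (S ^^ d)" using bij_S by (simp add: bij_is_inj inj_fn)
  have "inf (tower_base n) x = 0"
  proof (rule inf_tower_base_eq_0[OF assms(1)])
    fix i
    let ?l = "i * n + (n - 1) - d"
    \<comment> \<open>The natural subtraction is exact because \<open>d < n\<close>. Thus
      \<open>S ^^ d\<close> sends the piece at \<open>?l + d\<close> below the piece at
      \<open>?l\<close>.\<close>
    have l: "?l + d = i * n + (n - 1)" using assms by simp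
    \<comment> \<open>The index \<open>?k\<close> is \<open>n - 1\<close> modulo \<open>n\<close>,
      whereas \<open>?l\<close> is shifted off this class by \<open>d\<close>.\<close>
    have "?l \<noteq> ?k"
    proof
      assume "?l = ?k"
      then have "j * n + d = i * n" using l by simp
      then have "d mod n = 0" by (metis mod_mult_self2_is_0 mod_mult_self3 add.commute mult.commute)
      then show False using assms by simp
    qed
    have "inf ((S ^^ d) (a (?l + d))) (a ?k) = 0"
      by (rule inf_eq_0_mono[OF inf_a_a[OF \<open>?l \<noteq> ?k\<close>]])
        (use riesz_hom_mono[OF hom a_nonneg] linear_0[OF lin] S_pow_a_le in \<open>auto simp: a_nonneg\<close>)
    then have "(S ^^ d) (inf (a (?l + d)) x) = (S ^^ d) 0"
      using hom x linear_0[OF lin] by (simp add: riesz_hom_def)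
    then show "inf (a (i * n + (n - 1))) x = 0"
      using inj_d l by (simp add: inj_eq)
  qed
  then have "(S ^^ d) (inf (tower_base n) x) = 0" using linear_0[OF lin] by simp
  then show "inf (a ?k) ((S ^^ d) (tower_base n)) = 0"
    using hom x by (simp add: riesz_hom_def inf.commute)
qed

lemma S_pow_tower_base_pairwise_disjoint:
  assumes "i < n" "j < n" "i \<noteq> j"
  shows "inf ((S ^^ i) (tower_base n)) ((S ^^ j) (tower_base n)) = 0"
proof -
  have *: "inf ((S ^^ i) (tower_base n)) ((S ^^ j) (tower_base n)) = 0" if "i < j" "j < n" for i j
  proof -
    have hom: "riesz_hom (S ^^ i)" by (rule riesz_hom_funpow[OF riesz_S])
    have "(S ^^ i) (inf (tower_base n) ((S ^^ (j - i)) (tower_base n))) = 0"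
      using S_pow_tower_base_disjoint[of n "j - i"] that hom
      by (simp add: riesz_hom_def linear_0)
    moreover have "(S ^^ i) ((S ^^ (j - i)) x) = (S ^^ j) x" for x
      using that by (simp flip: funpow_add comp_apply[of "S ^^ i"])
    ultimately show ?thesis using hom by (simp add: riesz_hom_def)
  qed
  show ?thesis
    using *[of i j] *[of j i] assms by (cases "i < j") (auto simp: inf.commute)
qed

lemma S_pow_tower_base_nonneg:
  assumes "n \<ge> 1"
  shows "0 \<le> (S ^^ i) (tower_base n)"
  using riesz_hom_mono[OF riesz_hom_funpow[OF riesz_S], of 0 "tower_base n" i]
    riesz_hom_funpow[OF riesz_S, of i] component_of_tower_base[OF assms]
  by (simp add: component_of_def riesz_hom_def linear_0)

section \<open>Lower bounds for the image of the tower under \<open>T\<close>\<close>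

lemma T_b_le: "T (b k) \<le> real k *\<^sub>R T p"
proof (induction k)
  case 0
  show ?case using linear_0[OF linear_T] by simp
next
  case (Suc k)
  have "0 \<le> R (b k)"
    using component_of_R[OF component_of_b] by (simp add: component_of_def)
  \<comment> \<open>A supremum of positive elements lies below their sum. As \<open>R\<close>
    preserves \<open>T\<close>, each step costs at most one more \<open>T p\<close>.\<close>
  then have "b (Suc k) \<le> p + R (b k)"
    using p_nonneg by (simp add: add_increasing add_increasing2)
  from T_mono[OF this] Suc show ?case
    by (simp add: linear_add[OF linear_T] algebra_simps add_left_mono order_trans
        del: orbit_sup.simps)
qed

text \<open>Each new summand \<open>a ?k\<close> pays for a block: the \<open>n\<close> increments
  starting at \<open>?k\<close> telescope, and \<open>T\<close> of each is at most
  \<open>T (a ?k)\<close>.\<close>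

lemma T_tower_sum_ge:
  assumes "n \<ge> 1"
  shows "T (b (n - 1 + J * n)) - T (b (n - 1)) \<le> real n *\<^sub>R T (tower_sum n J)"
proof (induction J)
  case 0
  show ?case by (simp add: tower_sum_def linear_0[OF linear_T])
next
  case (Suc J)
  let ?k = "n - 1 + J * n"
  have "T (b (?k + n)) - T (b ?k) = (\<Sum>i<n. T (a (?k + i)))"
    unfolding linear_sum[OF linear_T, symmetric] sum_a linear_diff[OF linear_T] ..
  also have "\<dots> \<le> (\<Sum>i<n. T (a ?k))"
    by (intro sum_mono T_a_antimono)
  also have "\<dots> = real n *\<^sub>R T (a ?k)"
    by (simp only: sum_constant_scaleR card_lessThan)
  finally have "T (b (?k + n)) - T (b ?k) \<le> real n *\<^sub>R T (a ?k)" .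
  from add_mono[OF this Suc]
  have "T (b (?k + n)) - T (b (n - 1)) \<le> real n *\<^sub>R (T (a ?k) + T (tower_sum n J))"
    by (simp add: scaleR_add_right)
  moreover have "T (tower_sum n (Suc J)) = T (a ?k) + T (tower_sum n J)"
    by (simp add: tower_sum_def linear_add[OF linear_T] add.commute)
  moreover have "?k + n = n - 1 + Suc J * n" by simp
  ultimately show ?case by metis
qed

text \<open>The block estimate, with \<open>T (b (n - 1))\<close> bounded by \<open>n - 1\<close>
  copies of \<open>T p\<close>, bounds \<open>T (b J)\<close> uniformly in \<open>J\<close>. Order
  continuity carries this to \<open>T orb\<close>, which is \<open>orb\<close>.\<close>

lemma T_tower_base_ge:
  assumes "n \<ge> 1"
  shows "orb - (real n - 1) *\<^sub>R T p \<le> real n *\<^sub>R T (tower_base n)"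
proof -
  let ?c = "real n *\<^sub>R T (tower_base n) + (real n - 1) *\<^sub>R T p"
  have "T (b J) \<le> ?c" for J
  proof -
    \<comment> \<open>The indices \<open>n - 1 + J * n\<close> are cofinal, so the block estimate
      controls every \<open>b J\<close>.\<close>
    have "J \<le> n - 1 + J * n"
      by (rule trans_le_add2) (use assms in simp)
    then have "T (b J) \<le> T (b (n - 1 + J * n))"
      by (intro T_mono incseqD[OF incseq_b])
    also have "\<dots> \<le> real n *\<^sub>R T (tower_sum n J) + T (b (n - 1))"
      using T_tower_sum_ge[OF assms, of J] by (simp add: diff_le_eq)
    also have "\<dots> \<le> ?c"
    proof (rule add_mono)
      have "tower_sum n J \<le> tower_base n"
        using lub_tower_base[OF assms] by (auto simp: is_lub_in_def)
      then show "real n *\<^sub>R T (tower_sum n J) \<le> real n *\<^sub>R T (tower_base n)"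
        by (intro scaleR_left_mono T_mono) auto
      show "T (b (n - 1)) \<le> (real n - 1) *\<^sub>R T p"
        using T_b_le[of "n - 1"] assms by (simp add: of_nat_diff)
    qed
    finally show ?thesis .
  qed
  then have "T orb \<le> ?c"
    by (rule order_continuous_lub_le[OF order_continuous_T incseq_b lub_orb])
  then show ?thesis by (simp add: T_orb diff_le_eq)
qed

text \<open>Pairwise disjointness puts the sum of the \<open>n\<close> iterates below their
  supremum, and \<open>T\<close> takes the same value on each iterate. Positivity of
  \<open>T\<close> on the supremum accounts for the positive part.\<close>

lemma T_tower_ge:
  assumes "n \<ge> 1"
  shows "pprt (orb - (real n - 1) *\<^sub>R T p) \<le> T (SUP j\<in>{..<n}. (S ^^ j) (tower_base n))"
proof -
  let ?q = "tower_base n" and ?u = "SUP j\<in>{..<n}. (S ^^ j) (tower_base n)"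
  have le: "(S ^^ j) ?q \<le> ?u" if "j < n" for j
    using that by (intro cSUP_upper bdd_above_finite) auto
  have "(\<Sum>j<m. (S ^^ j) ?q) \<le> ?u" if "m \<le> n" for m
    using that
  proof (induction m)
    case 0
    then show ?case
      using le[of 0] S_pow_tower_base_nonneg[OF assms, of 0] assms by simp
  next
    case (Suc m)
    have "inf (\<Sum>j<m. (S ^^ j) ?q) ((S ^^ m) ?q) = 0"
      using Suc.prems S_pow_tower_base_nonneg[OF assms]
      by (intro inf_sum_eq_0 S_pow_tower_base_pairwise_disjoint) auto
    then show ?case
      using add_le_of_inf_eq_0 Suc le[of m] by simp
  qed
  from T_mono[OF this[OF order_refl]] have "real n *\<^sub>R T ?q \<le> T ?u"
    by (simp add: linear_sum[OF linear_T] sum_constant_scaleR)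
  moreover have "0 \<le> T ?u"
    using le[of 0] S_pow_tower_base_nonneg[OF assms, of 0] assms T_nonneg by simp
  ultimately show ?thesis
    using T_tower_base_ge[OF assms] by (simp add: pprt_def)
qed

end

theorem theorem3p2:
  fixes T S :: "'a::dedekind_complete_riesz_space \<Rightarrow> 'a"
    and e p :: 'a
    and \<iota> :: "'a \<Rightarrow> 'u::dedekind_complete_riesz_space"
    and n :: nat
  assumes "ceps T S e"
    and "conditionally_ergodic T S"
    and "strictly_positive T"
    and "universal_completion \<iota>"
    and "T_universally_complete \<iota> T"
    and "surj S"
    and "n \<ge> 1"
    and "component_of p e"
  shows "\<exists>q. component_of q (band_proj (T p) e) \<and>
           (\<forall>i<n. \<forall>j<n. i \<noteq> j \<longrightarrow> disjoint_elems ((S ^^ i) q) ((S ^^ j) q)) \<and>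
           T (SUP j\<in>{..<n}. (S ^^ j) q) \<ge> pprt (band_proj (T p) e - (real n - 1) *\<^sub>R T p)"
proof -
  interpret ceps_automorphism T S e p
    using assms by unfold_locales
  have "component_of (tower_base n) orb"
    using component_of_subcomponent[OF component_of_tower_base tower_base_le_orb] \<open>n \<ge> 1\<close>
      component_of_orb by (auto simp: component_of_def)
  moreover have "disjoint_elems ((S ^^ i) (tower_base n)) ((S ^^ j) (tower_base n))"
    if "i < n" "j < n" "i \<noteq> j" for i j
    using S_pow_tower_base_pairwise_disjoint[OF that] S_pow_tower_base_nonneg[OF \<open>n \<ge> 1\<close>]
    by (simp add: disjoint_elems_def)
  ultimately show ?thesis
    unfolding band_proj_eq_orb using T_tower_ge[OF \<open>n \<ge> 1\<close>] by blast
qed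

end
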